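(* Let $k$ be a positive integer and let $P$ be a finite poset with $e^*(P)\le k-2$. Then there is a constant $K_P$, independent of $n$, such that $\mathrm{sat}^*(n,C_k+P)\le K_P$ for all $n$.
   Context: $C_k$ is the chain on $k$ elements; $Q+R$ denotes the disjoint union of posets $Q$ and $R$ with no relations between elements of $Q$ and elements of $R$. For a Boolean lattice $2^{[\ell]}$, level $i$ is the family of $i$-element subsets. $e^*(P)$ is the maximum number $k$ such that the union of any $k$ complete and consecutive levels of any Boolean lattice contains no induced copy of $P$. A subfamily $\mathcal G\subseteq\mathcal F\subseteq 2^{[n]}$ is an induced copy of $P$ if there is a bijection $i:P\to\mathcal G$ with $p\le_P q$ iff $i(p)\subseteq i(q)$; $\mathcal F$ is induced $P$-saturating if it has no induced copy of $P$ and adding any $G\in2^{[n]}\setminus\mathcal F$ creates one. $\mathrm{sat}^*(n,P)$ is the minimum size of an induced $P$-saturating family in $2^{[n]}$. *)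

theory Defs
  imports Main
begin

text \<open>
  A poset is given by its reflexive order relation \<open>P :: 'a rel\<close>; its ground set is
  \<^term>\<open>Field P\<close>.
\<close>

definition chain_poset :: "nat \<Rightarrow> nat rel" where
  "chain_poset k = natLeq_on k"

definition disjoint_union :: "'a rel \<Rightarrow> 'b rel \<Rightarrow> ('a + 'b) rel" where
  "disjoint_union Q R = {(Inl x, Inl y) | x y. (x, y) \<in> Q} \<union> {(Inr x, Inr y) | x y. (x, y) \<in> R}"

definition induced_copy :: "nat set set \<Rightarrow> 'a rel \<Rightarrow> bool" where
  "induced_copy \<G> P \<longleftrightarrow>
     (\<exists>i. bij_betw i (Field P) \<G> \<and>
          (\<forall>p\<in>Field P. \<forall>q\<in>Field P. (p, q) \<in> P \<longleftrightarrow> i p \<subseteq> i q))"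

definition contains_induced :: "nat set set \<Rightarrow> 'a rel \<Rightarrow> bool" where
  "contains_induced \<F> P \<longleftrightarrow> (\<exists>\<G>\<subseteq>\<F>. induced_copy \<G> P)"

definition level :: "nat \<Rightarrow> nat \<Rightarrow> nat set set" where
  "level l i = {A. A \<subseteq> {1..l} \<and> card A = i}"

text \<open>
  The levels \<open>a, \<dots>, a + k - 1\<close> all exist in the Boolean lattice on \<open>{1..l}\<close> iff
  \<open>a + k \<le> l + 1\<close>.
\<close>

definition avoids_levels :: "nat \<Rightarrow> 'a rel \<Rightarrow> bool" where
  "avoids_levels k P \<longleftrightarrow>
     (\<forall>l a. a + k \<le> l + 1 \<longrightarrow> \<not> contains_induced (\<Union>i\<in>{a..<a + k}. level l i) P)"

text \<open>
  For a finite nonempty poset this maximum exists (lemma \<open>avoids_levels_e_star\<close> below). For the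
  empty poset no \<open>k\<close> qualifies, and the value is unspecified.
\<close>

definition e_star :: "'a rel \<Rightarrow> nat" where
  "e_star P = (GREATEST k. avoids_levels k P)"

definition induced_saturating :: "nat \<Rightarrow> 'a rel \<Rightarrow> nat set set \<Rightarrow> bool" where
  "induced_saturating n P \<F> \<longleftrightarrow>
     \<F> \<subseteq> Pow {1..n} \<and> \<not> contains_induced \<F> P \<and>
     (\<forall>G\<in>Pow {1..n} - \<F>. contains_induced (insert G \<F>) P)"

text \<open>For a nonempty poset the minimum is attained (lemma \<open>sat_star_attained\<close> below).\<close>

definition sat_star :: "nat \<Rightarrow> 'a rel \<Rightarrow> nat" where
  "sat_star n P = (LEAST m. \<exists>\<F>. induced_saturating n P \<F> \<and> card \<F> = m)"

lemma not_contains_induced_empty: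
  assumes "Field P \<noteq> {}"
  shows "\<not> contains_induced {} P"
  using assms by (auto simp: contains_induced_def induced_copy_def bij_betw_def)

lemma contains_induced_mono:
  "contains_induced \<F> P \<Longrightarrow> \<F> \<subseteq> \<H> \<Longrightarrow> contains_induced \<H> P"
  unfolding contains_induced_def by (meson order_trans)

lemma contains_induced_Pow:
  assumes P: "Partial_order P" and fin: "finite (Field P)" and l: "card (Field P) \<le> l"
  shows "contains_induced (Pow {1..l}) P"
proof -
  obtain f where f: "inj_on f (Field P)" "f ` Field P \<subseteq> {1..l}"
    using card_le_inj[OF fin, of "{1..l}"] l by auto
  define i where "i p = f ` {q. (q, p) \<in> P}" for p
  have down: "{q. (q, p) \<in> P} \<subseteq> Field P" for p
    by (auto simp: Field_def)
  have refl: "(p, p) \<in> P" if "p \<in> Field P" for p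
    using P that by (auto simp: partial_order_on_def preorder_on_def refl_on_def)
  have trans: "trans P" and antisym: "antisym P"
    using P by (auto simp: partial_order_on_def preorder_on_def)
  have ord: "(p, q) \<in> P \<longleftrightarrow> i p \<subseteq> i q" if "p \<in> Field P" "q \<in> Field P" for p q
  proof -
    have "i p \<subseteq> i q \<longleftrightarrow> {r. (r, p) \<in> P} \<subseteq> {r. (r, q) \<in> P}"
    proof
      assume sub: "i p \<subseteq> i q"
      show "{r. (r, p) \<in> P} \<subseteq> {r. (r, q) \<in> P}"
      proof
        fix r assume r: "r \<in> {r. (r, p) \<in> P}"
        then have "f r \<in> f ` {r. (r, q) \<in> P}" using sub unfolding i_def by blast
        then show "r \<in> {r. (r, q) \<in> P}"
          using inj_on_image_mem_iff[OF f(1) _ down] r down by blast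
      qed
    qed (auto simp: i_def)
    also have "\<dots> \<longleftrightarrow> (p, q) \<in> P"
      using refl[OF that(1)] transD[OF trans] by blast
    finally show ?thesis by simp
  qed
  have "inj_on i (Field P)"
  proof (rule inj_onI)
    fix p q assume "p \<in> Field P" "q \<in> Field P" "i p = i q"
    then have "(p, q) \<in> P" "(q, p) \<in> P" using ord by simp_all
    then show "p = q" using antisymD[OF antisym] by blast
  qed
  then have "induced_copy (i ` Field P) P"
    unfolding induced_copy_def using ord by (intro exI[of _ i]) (simp add: bij_betw_def)
  moreover have "i ` Field P \<subseteq> Pow {1..l}"
    using f(2) down unfolding i_def by blast
  ultimately show ?thesis unfolding contains_induced_def by blast
qed

lemma avoids_levels_bound:
  assumes "Partial_order P" "finite (Field P)" "avoids_levels k P"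
  shows "k \<le> card (Field P)"
proof (rule ccontr)
  assume "\<not> k \<le> card (Field P)"
  then have k: "card (Field P) \<le> k - 1" "0 < k" by auto
  have "A \<in> (\<Union>i\<in>{0..<0 + k}. level (k - 1) i)" if "A \<subseteq> {1..k - 1}" for A
    using that k(2) card_mono[of "{1..k - 1}" A] by (auto simp: level_def)
  then have "Pow {1..k - 1} \<subseteq> (\<Union>i\<in>{0..<0 + k}. level (k - 1) i)" by blast
  moreover have "contains_induced (Pow {1..k - 1}) P"
    using contains_induced_Pow assms(1,2) k(1) .
  ultimately have "contains_induced (\<Union>i\<in>{0..<0 + k}. level (k - 1) i) P"
    by (metis contains_induced_mono)
  moreover have "0 + k \<le> (k - 1) + 1" using k(2) by simp
  ultimately show False
    using assms(3) unfolding avoids_levels_def by blast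
qed

lemma avoids_levels_e_star:
  assumes "Partial_order P" "finite (Field P)" "Field P \<noteq> {}"
  shows "avoids_levels (e_star P) P" and "avoids_levels k P \<Longrightarrow> k \<le> e_star P"
proof -
  have 0: "avoids_levels 0 P"
    using not_contains_induced_empty[OF assms(3)] by (auto simp: avoids_levels_def)
  note b = avoids_levels_bound[OF assms(1,2)]
  show "avoids_levels (e_star P) P"
    unfolding e_star_def using GreatestI_nat[where P = "\<lambda>k. avoids_levels k P", OF 0] b by blast
  show "k \<le> e_star P" if "avoids_levels k P"
    unfolding e_star_def using Greatest_le_nat[where P = "\<lambda>k. avoids_levels k P", OF that] b by blast
qed

lemma sat_star_attained:
  assumes "Field P \<noteq> {}"
  shows "\<exists>\<F>. induced_saturating n P \<F> \<and> card \<F> = sat_star n P"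
    and "induced_saturating n P \<F> \<Longrightarrow> sat_star n P \<le> card \<F>"
proof -
  define S where "S = {\<F>. \<F> \<subseteq> Pow {1..n} \<and> \<not> contains_induced \<F> P}"
  have "S \<subseteq> Pow (Pow {1..n})" unfolding S_def by blast
  then have fin: "finite S" by (rule finite_subset) simp
  have "{} \<in> S" unfolding S_def using not_contains_induced_empty[OF assms] by simp
  then have "S \<noteq> {}" by blast
  from finite_has_maximal[OF fin this]
  obtain M where M: "M \<in> S" and max: "\<forall>\<F>\<in>S. M \<subseteq> \<F> \<longrightarrow> M = \<F>" by blast
  have M': "M \<subseteq> Pow {1..n}" "\<not> contains_induced M P"
    using M unfolding S_def by simp_all
  have "contains_induced (insert G M) P" if "G \<in> Pow {1..n} - M" for G
  proof (rule ccontr)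
    assume "\<not> contains_induced (insert G M) P"
    then have "insert G M \<in> S" using that M'(1) unfolding S_def by simp
    then have "M = insert G M" using max by blast
    then show False using that by blast
  qed
  then have "induced_saturating n P M"
    using M' unfolding induced_saturating_def by simp
  then have "\<exists>m \<F>. induced_saturating n P \<F> \<and> card \<F> = m" by blast
  then show "\<exists>\<F>. induced_saturating n P \<F> \<and> card \<F> = sat_star n P"
    unfolding sat_star_def by (rule LeastI_ex)
  show "sat_star n P \<le> card \<F>" if "induced_saturating n P \<F>"
    unfolding sat_star_def using that by (intro Least_le) blast
qed

end

theory Submission
  imports Defs
begin

text \<open>
  Since \<open>e\<^sup>*(P) < k - 1\<close>, some \<open>m = k - 1\<close> consecutive levels of a Boolean lattice contain \<open>P\<close>.
  Fix a constant \<open>s\<close> and treat \<open>B = {s<..n}\<close> as a single atom: the sets that contain \<open>B\<close> or miss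
  it form a Boolean lattice \<open>D\<close> of constant size. The union of \<open>m\<close> consecutive levels of \<open>D\<close> has
  no chain of length \<open>k\<close>, hence no copy of \<open>C\<^sub>k + P\<close>. A set \<open>G\<close> that splits \<open>B\<close> lies strictly
  between two consecutive levels of \<open>D\<close> (or below or above all \<open>m\<close> of them), so it extends a chain
  of \<open>m\<close> sets to one of length \<open>k\<close>, and for large \<open>s\<close> there is room for a copy of \<open>P\<close> incomparable
  to this chain. So a maximal extension inside \<open>D\<close> is saturating.
\<close>

section \<open>Order embeddings, copies of a chain plus a poset, and saturating extensions\<close>

lemma contains_inducedD:
  assumes "contains_induced \<F> P"
  obtains i where "i ` Field P \<subseteq> \<F>"
    and "\<forall>p\<in>Field P. \<forall>q\<in>Field P. (p, q) \<in> P \<longleftrightarrow> i p \<subseteq> i q"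
  using assms unfolding contains_induced_def induced_copy_def by (auto simp: bij_betw_def)

lemma contains_inducedI:
  assumes "antisym P" and "i ` Field P \<subseteq> \<F>"
    and ord: "\<And>p q. p \<in> Field P \<Longrightarrow> q \<in> Field P \<Longrightarrow> (p, q) \<in> P \<longleftrightarrow> i p \<subseteq> i q"
  shows "contains_induced \<F> P"
proof -
  have "inj_on i (Field P)"
    by (rule inj_onI) (metis assms(1) antisymD ord order_refl)
  then have "induced_copy (i ` Field P) P"
    unfolding induced_copy_def using ord by (intro exI[of _ i]) (simp add: bij_betw_def)
  then show ?thesis
    using assms(2) unfolding contains_induced_def by blast
qed

lemma disjoint_union_iff [simp]:
  "(Inl x, Inl y) \<in> disjoint_union Q R \<longleftrightarrow> (x, y) \<in> Q"
  "(Inr u, Inr v) \<in> disjoint_union Q R \<longleftrightarrow> (u, v) \<in> R"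
  "(Inl x, Inr v) \<notin> disjoint_union Q R"
  "(Inr u, Inl y) \<notin> disjoint_union Q R"
  by (auto simp: disjoint_union_def)

lemma Field_disjoint_union: "Field (disjoint_union Q R) = Field Q <+> Field R"
  by (auto simp: disjoint_union_def Field_def Domain_iff Range_iff)

lemma antisym_disjoint_union: "antisym Q \<Longrightarrow> antisym R \<Longrightarrow> antisym (disjoint_union Q R)"
  by (rule antisymI) (auto simp: disjoint_union_def dest: antisymD)

lemma chain_poset_iff: "(x, y) \<in> chain_poset (Suc m) \<longleftrightarrow> x \<le> y \<and> y \<le> m"
  by (auto simp: chain_poset_def)

lemma Field_chain_poset: "Field (chain_poset (Suc m)) = {..m}"
  by (auto simp: Field_def Domain_iff Range_iff chain_poset_iff)

lemma antisym_chain_poset: "antisym (chain_poset k)"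
  by (rule antisymI) (auto simp: chain_poset_def)

text \<open>As \<open>c\<close> increases, incomparability with the whole chain reduces to two tests
  for each \<open>p\<close>: \<open>i p\<close> is not contained in the top set and does not contain
  the bottom set.\<close>

lemma contains_chain_plusI:
  fixes c :: "nat \<Rightarrow> nat set"
  assumes "antisym P"
    and c: "\<And>j. j \<le> m \<Longrightarrow> c j \<in> \<F>" "\<And>j. j < m \<Longrightarrow> c j \<subset> c (Suc j)"
    and i: "i ` Field P \<subseteq> \<F>"
      "\<And>p q. p \<in> Field P \<Longrightarrow> q \<in> Field P \<Longrightarrow> (p, q) \<in> P \<longleftrightarrow> i p \<subseteq> i q"
    and incomp: "\<And>p. p \<in> Field P \<Longrightarrow> \<not> i p \<subseteq> c m" "\<And>p. p \<in> Field P \<Longrightarrow> \<not> c 0 \<subseteq> i p"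
  shows "contains_induced \<F> (disjoint_union (chain_poset (Suc m)) P)"
proof (rule contains_inducedI[where i = "case_sum c i"])
  show "antisym (disjoint_union (chain_poset (Suc m)) P)"
    by (intro antisym_disjoint_union antisym_chain_poset assms(1))
  show "case_sum c i ` Field (disjoint_union (chain_poset (Suc m)) P) \<subseteq> \<F>"
    using c(1) i(1) by (auto simp: Field_disjoint_union Field_chain_poset)
  have mono: "c x \<subseteq> c y" if "x \<le> y" "y \<le> m" for x y
    using that
  proof (induction y rule: dec_induct)
    case (step n)
    then have "c x \<subseteq> c n" "c n \<subset> c (Suc n)" using c(2)[of n] by simp_all
    then show ?case by blast
  qed simp
  have less: "c x \<subset> c y" if "x < y" "y \<le> m" for x y
    using mono[of "Suc x" y] c(2)[of x] that by auto
  have c_iff: "x \<le> y \<longleftrightarrow> c x \<subseteq> c y" if "x \<le> m" "y \<le> m" for x y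
    using mono[of x y] less[of y x] that by (meson leD not_le_imp_less psubset_eq subset_not_subset_eq)
  have up: "\<not> i p \<subseteq> c x" if "p \<in> Field P" "x \<le> m" for p x
    using incomp(1)[OF that(1)] mono[of x m] that(2) by blast
  have down: "\<not> c x \<subseteq> i p" if "p \<in> Field P" "x \<le> m" for p x
    using incomp(2)[OF that(1)] mono[of 0 x] that(2) by blast
  show "(p, q) \<in> disjoint_union (chain_poset (Suc m)) P \<longleftrightarrow> case_sum c i p \<subseteq> case_sum c i q"
    if "p \<in> Field (disjoint_union (chain_poset (Suc m)) P)"
      and "q \<in> Field (disjoint_union (chain_poset (Suc m)) P)" for p q
    using that c_iff i(2) up down
    by (cases p; cases q) (auto simp: Field_disjoint_union Field_chain_poset chain_poset_iff)
qed

text \<open>Along a chain of \<open>Suc m\<close> sets the rank rises by at least one per step, so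
  it leaves a window of \<open>m\<close> values.\<close>

lemma not_contains_chain_plus:
  fixes r :: "nat set \<Rightarrow> nat"
  assumes mono: "\<And>A A'. A \<in> \<F> \<Longrightarrow> A' \<in> \<F> \<Longrightarrow> A \<subset> A' \<Longrightarrow> r A < r A'"
    and bound: "\<And>A. A \<in> \<F> \<Longrightarrow> a \<le> r A \<and> r A < a + m"
  shows "\<not> contains_induced \<F> (disjoint_union (chain_poset (Suc m)) P)"
proof
  assume "contains_induced \<F> (disjoint_union (chain_poset (Suc m)) P)"
  then obtain i where i: "i ` Field (disjoint_union (chain_poset (Suc m)) P) \<subseteq> \<F>"
    and ord: "\<forall>p\<in>Field (disjoint_union (chain_poset (Suc m)) P).
      \<forall>q\<in>Field (disjoint_union (chain_poset (Suc m)) P).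
        (p, q) \<in> disjoint_union (chain_poset (Suc m)) P \<longleftrightarrow> i p \<subseteq> i q"
    by (rule contains_inducedD)
  have mem: "i (Inl x) \<in> \<F>" if "x \<le> m" for x
    using i that by (auto simp: Field_disjoint_union Field_chain_poset)
  have ord': "x \<le> y \<longleftrightarrow> i (Inl x) \<subseteq> i (Inl y)" if "x \<le> m" "y \<le> m" for x y
    using ord[rule_format, of "Inl x" "Inl y"] that
    by (simp add: Field_disjoint_union Field_chain_poset chain_poset_iff InlI)
  have "x \<le> m \<Longrightarrow> a + x \<le> r (i (Inl x))" for x
  proof (induction x)
    case 0
    then show ?case using bound mem by simp
  next
    case (Suc x)
    have "i (Inl x) \<subset> i (Inl (Suc x))"
      using ord'[of x "Suc x"] ord'[of "Suc x" x] Suc.prems by auto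
    then have "r (i (Inl x)) < r (i (Inl (Suc x)))"
      using mem Suc.prems by (intro mono) auto
    then show ?case using Suc by simp
  qed
  from this[of m] show False using bound[OF mem[of m]] by simp
qed

text \<open>Take a maximal copy-free family between the initial one and \<open>D\<close>. Maximality
  handles the new sets inside \<open>D\<close>, the last hypothesis those outside. The size of
  \<open>D\<close> then bounds the saturating family.\<close>

lemma saturating_extension:
  assumes "\<F>\<^sub>0 \<subseteq> D" and D: "D \<subseteq> Pow {1..n}" and "\<not> contains_induced \<F>\<^sub>0 P"
    and G: "\<And>G. G \<subseteq> {1..n} \<Longrightarrow> G \<notin> D \<Longrightarrow> contains_induced (insert G \<F>\<^sub>0) P"
  obtains \<F> where "\<F> \<subseteq> D" "induced_saturating n P \<F>"
proof -
  define S where "S = {\<F>. \<F> \<subseteq> D \<and> \<not> contains_induced \<F> P}"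
  have "finite S"
    by (rule finite_subset[of _ "Pow D"]) (use D in \<open>auto simp: S_def intro: finite_subset\<close>)
  moreover have "\<F>\<^sub>0 \<in> S" using assms unfolding S_def by simp
  ultimately obtain M where M: "M \<in> S" "\<F>\<^sub>0 \<subseteq> M" and max: "\<And>\<F>. \<F> \<in> S \<Longrightarrow> M \<subseteq> \<F> \<Longrightarrow> M = \<F>"
    by (metis finite_has_maximal2)
  have "contains_induced (insert X M) P" if X: "X \<in> Pow {1..n} - M" for X
  proof (cases "X \<in> D")
    case True
    then show ?thesis using max[of "insert X M"] X M(1) unfolding S_def by blast
  next
    case False
    then have "contains_induced (insert X \<F>\<^sub>0) P" using G X by blast
    then show ?thesis by (rule contains_induced_mono) (use M(2) in blast)
  qed
  then have "induced_saturating n P M"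
    using M D unfolding induced_saturating_def S_def by blast
  then show ?thesis using that M(1) unfolding S_def by blast
qed

section \<open>The lattice with one block as an atom\<close>

text \<open>\<open>blowup s n\<close> is the lattice \<open>D\<close> of the introduction.\<close>

definition blowup :: "nat \<Rightarrow> nat \<Rightarrow> nat set set" where
  "blowup s n = {A. A \<subseteq> {1..n} \<and> ({s<..n} \<subseteq> A \<or> A \<inter> {s<..n} = {})}"

text \<open>For \<open>s < n\<close> this is the rank function of \<open>blowup s n\<close>: the
  block \<open>{s<..n}\<close> counts as one atom whatever its size.\<close>

definition blowup_rank :: "nat \<Rightarrow> nat \<Rightarrow> nat set \<Rightarrow> nat" where
  "blowup_rank s n A = card (A \<inter> {1..s}) + (if {s<..n} \<subseteq> A then 1 else 0)"

definition blowup_levels :: "nat \<Rightarrow> nat \<Rightarrow> nat \<Rightarrow> nat \<Rightarrow> nat set set" where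
  "blowup_levels s n a m = {A \<in> blowup s n. a \<le> blowup_rank s n A \<and> blowup_rank s n A < a + m}"

text \<open>A member is determined by its trace on \<open>{1..s}\<close> and by whether it contains
  the block, so the bound is free of \<open>n\<close>.\<close>

lemma card_blowup: "card (blowup s n) \<le> 2 ^ Suc s"
proof -
  have "blowup s n \<subseteq> Pow {1..s} \<union> (\<lambda>X. X \<union> {s<..n}) ` Pow {1..s}"
  proof
    fix A assume A: "A \<in> blowup s n"
    show "A \<in> Pow {1..s} \<union> (\<lambda>X. X \<union> {s<..n}) ` Pow {1..s}"
    proof (cases "{s<..n} \<subseteq> A")
      case True
      then have "A = (A \<inter> {1..s}) \<union> {s<..n}" using A by (auto simp: blowup_def)
      then show ?thesis by blast
    next
      case False
      then have "A \<subseteq> {1..s}" using A by (force simp: blowup_def)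
      then show ?thesis by blast
    qed
  qed
  then have "card (blowup s n) \<le> card (Pow {1..s} \<union> (\<lambda>X. X \<union> {s<..n}) ` Pow {1..s})"
    by (intro card_mono) simp_all
  also have "\<dots> \<le> card (Pow {1..s}) + card ((\<lambda>X. X \<union> {s<..n}) ` Pow {1..s})"
    by (rule card_Un_le)
  also have "\<dots> \<le> card (Pow {1..s}) + card (Pow {1..s})"
    by (intro add_left_mono card_image_le) simp
  also have "\<dots> = 2 ^ Suc s" by (simp add: card_Pow)
  finally show ?thesis .
qed

text \<open>Either the trace on \<open>{1..s}\<close> grows, or the traces agree and the new element
  lies in the block, which then belongs to \<open>A'\<close> but not to \<open>A\<close>.\<close>

lemma blowup_rank_less:
  assumes "s < n" "A \<in> blowup s n" "A' \<in> blowup s n" "A \<subset> A'"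
  shows "blowup_rank s n A < blowup_rank s n A'"
proof -
  have le: "card (A \<inter> {1..s}) \<le> card (A' \<inter> {1..s})"
    by (rule card_mono) (use assms(4) in auto)
  show ?thesis
  proof (cases "A \<inter> {1..s} = A' \<inter> {1..s}")
    case True
    obtain x where x: "x \<in> A'" "x \<notin> A" using assms(4) by blast
    then have "x \<in> {s<..n}" using True assms(3) by (force simp: blowup_def)
    then have "{s<..n} \<subseteq> A'" "\<not> {s<..n} \<subseteq> A" using x assms(3) by (auto simp: blowup_def)
    then show ?thesis using le by (simp add: blowup_rank_def)
  next
    case False
    then have "card (A \<inter> {1..s}) < card (A' \<inter> {1..s})"
      by (intro psubset_card_mono) (use assms(4) in auto)
    then show ?thesis using assms(4) by (auto simp: blowup_rank_def)
  qed
qed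

section \<open>The copy created by a set that splits the block\<close>

lemma obtain_enumeration_initial:
  fixes T S :: "'a set"
  assumes "finite S" "T \<subseteq> S"
  obtains h where "bij_betw h {..<card S} S" "h ` {..<card T} = T"
proof -
  have fT: "finite T" using assms finite_subset by blast
  obtain f where f: "bij_betw f {..<card T} T"
    using ex_bij_betw_nat_finite[OF fT] by (auto simp: atLeast0LessThan)
  have cST: "card T \<le> card S" using assms by (intro card_mono)
  have "card {card T..<card S} = card (S - T)"
    using card_Diff_subset[OF fT assms(2)] by simp
  then obtain g where g: "bij_betw g {card T..<card S} (S - T)"
    using finite_same_card_bij[of "{card T..<card S}" "S - T"] assms(1) by auto
  define h where "h x = (if x < card T then f x else g x)" for x
  have h1: "bij_betw h {..<card T} T"
    using f bij_betw_cong[of "{..<card T}" h f] by (simp add: h_def)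
  have h2: "bij_betw h {card T..<card S} (S - T)"
    using g bij_betw_cong[of "{card T..<card S}" h g] by (simp add: h_def)
  have "{..<card T} \<union> {card T..<card S} = {..<card S}" "T \<union> (S - T) = S"
    using cST assms(2) by auto
  then have "bij_betw h {..<card S} S"
    using bij_betw_combine[OF h1 h2] by auto
  then show ?thesis using that h1 by (auto simp: bij_betw_def)
qed

text \<open>The bounds on \<open>card (f p)\<close> allow for one extra atom, with which the copy of
  \<open>P\<close> lands in ranks \<open>a\<close> to \<open>a + m - 1\<close>. The size
  \<open>s\<close> provides \<open>a + m\<close> elements for the chain, one spare element and
  \<open>l\<close> for the copy of \<open>P\<close>.\<close>

lemma splitting_set_creates_copy:
  fixes f :: "'a \<Rightarrow> nat set"
  assumes P: "antisym P" and a: "0 < a" and m: "0 < m" and s: "s = a + m + l + 1"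
    and f: "\<And>p. p \<in> Field P \<Longrightarrow> f p \<subseteq> {1..l} \<and> a \<le> Suc (card (f p)) \<and> card (f p) + 1 < a + m"
      "\<And>p q. p \<in> Field P \<Longrightarrow> q \<in> Field P \<Longrightarrow> (p, q) \<in> P \<longleftrightarrow> f p \<subseteq> f q"
    and G: "G \<subseteq> {1..n}" "G \<notin> blowup s n"
  shows "contains_induced (insert G (blowup_levels s n a m)) (disjoint_union (chain_poset (Suc m)) P)"
proof -
  define S B t where "S = {1..s}" and "B = {s<..n}" and "t = card (G \<inter> S)"
  have split: "\<not> B \<subseteq> G" "G \<inter> B \<noteq> {}"
    using G by (auto simp: blowup_def B_def)
  then have "s < n" by (auto simp: B_def)
  then have univ: "{1..n} = S \<union> B" and disj: "S \<inter> B = {}"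
    by (auto simp: S_def B_def)
  have cS: "card S = s" "finite S" by (simp_all add: S_def)
  \<comment> \<open>Listing \<open>G \<inter> S\<close> first makes every initial segment of the
    enumeration comparable with it.\<close>
  obtain h where h: "bij_betw h {..<s} S" "h ` {..<t} = G \<inter> S"
    using obtain_enumeration_initial[of S "G \<inter> S"] cS unfolding t_def by auto
  have inj: "inj_on h {..<s}" and hS: "h ` {..<s} = S" using h(1) by (auto simp: bij_betw_def)
  have hX: "h ` X \<subseteq> S" "card (h ` X) = card X" if "X \<subseteq> {..<s}" for X
    using that hS inj by (auto intro: card_image inj_on_subset)
  have h_less: "h ` X \<subset> h ` Y" if "X \<subset> Y" "Y \<subseteq> {..<s}" for X Y
    using image_strict_mono[OF inj_on_subset[OF inj that(2)] that(1)] .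
  have t_le: "t \<le> s" unfolding t_def using cS by (metis card_mono inf_le2)
  have rank_eq: "blowup_rank s n A = card (A \<inter> S) + (if B \<subseteq> A then 1 else 0)" for A
    unfolding blowup_rank_def S_def B_def ..
  have blowup_iff: "A \<in> blowup s n \<longleftrightarrow> A \<subseteq> S \<union> B \<and> (B \<subseteq> A \<or> A \<inter> B = {})" for A
    unfolding blowup_def mem_Collect_eq univ B_def[symmetric] ..
  have lev: "X \<union> W \<in> blowup_levels s n a m"
    if "X \<subseteq> S" "W = {} \<and> r = card X \<or> W = B \<and> r = Suc (card X)" "a \<le> r" "r < a + m" for X W r
  proof -
    have XB: "X \<inter> B = {}" "X \<inter> S = X" and BS: "B \<inter> S = {}" "B \<noteq> {}"
      using that(1) disj split(2) by blast+
    have "blowup_rank s n (X \<union> W) = r \<and> X \<union> W \<in> blowup s n"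
      using that(2)
    proof (elim disjE conjE)
      assume "W = {}" "r = card X"
      moreover have "\<not> B \<subseteq> X" using XB(1) BS(2) by blast
      ultimately show ?thesis
        using that(1) XB by (auto simp: rank_eq blowup_iff)
    next
      assume "W = B" "r = Suc (card X)"
      moreover have "(X \<union> B) \<inter> S = X" using XB BS by blast
      ultimately show ?thesis
        using that(1) by (auto simp: rank_eq blowup_iff)
    qed
    then show ?thesis using that(3,4) by (simp add: blowup_levels_def)
  qed

  \<comment> \<open>The position of \<open>G\<close> in the chain. The first \<open>a + j\<close>
    elements lie in \<open>G\<close> iff \<open>a + j \<le> t\<close>; this holds for
    \<open>t + 1 - a\<close> values of \<open>j\<close> (0 by truncation if \<open>t < a\<close>),
    capped at \<open>m\<close>.\<close>
  define g where "g = min m (t + 1 - a)"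
  \<comment> \<open>Before \<open>G\<close> the rank of \<open>c j\<close> is \<open>a + j\<close>;
    after it, \<open>a + j - 2\<close> elements and the block give \<open>a + j - 1\<close>. So the
    other \<open>m\<close> sets use each rank of the window once. As \<open>a\<close> and
    \<open>j\<close> are positive after \<open>G\<close>, nothing is truncated.\<close>
  define c where "c j = (if j < g then h ` {..<a + j} else if j = g then G
    else h ` {..<a + j - 2} \<union> B)" for j
  have c_mem: "c j \<in> insert G (blowup_levels s n a m)" if "j \<le> m" for j
  proof -
    consider "j < g" | "j = g" | "j > g" by linarith
    then show ?thesis
    proof cases
      case 1
      have "h ` {..<a + j} \<union> {} \<in> blowup_levels s n a m"
        by (rule lev[where r = "a + j"]) (use 1 s in \<open>auto simp: g_def hX\<close>)
      then show ?thesis using 1 by (simp add: c_def)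
    next
      case 2
      then show ?thesis by (simp add: c_def)
    next
      case 3
      have "h ` {..<a + j - 2} \<union> B \<in> blowup_levels s n a m"
        by (rule lev[where r = "a + j - 1"]) (use 3 s that a in \<open>auto simp: hX\<close>)
      then show ?thesis using 3 by (simp add: c_def)
    qed
  qed
  have c_less: "c j \<subset> c (Suc j)" if "j < m" for j
  proof -
    consider "Suc j < g" | "Suc j = g" | "j = g" | "j > g" by linarith
    then show ?thesis
    proof cases
      case 1
      have "h ` {..<a + j} \<subset> h ` {..<a + Suc j}"
        by (rule h_less) (use that s in auto)
      then show ?thesis using 1 by (simp add: c_def)
    next
      case 2
      then have "a + j \<le> t" by (auto simp: g_def)
      then have "h ` {..<a + j} \<subseteq> G \<inter> S" unfolding h(2)[symmetric] by auto
      \<comment> \<open>Strict because \<open>G\<close> meets the block and the segment does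
        not.\<close>
      then have "h ` {..<a + j} \<subset> G" using split(2) disj by blast
      then show ?thesis using 2 by (simp add: c_def)
    next
      case 3
      \<comment> \<open>Since \<open>g < m\<close>, the cap is inactive, so the next segment already
        covers \<open>G \<inter> S\<close>; the inclusion is strict because \<open>G\<close> misses
        part of the block.\<close>
      then have "g = t + 1 - a" using that by (auto simp: g_def)
      then have "t \<le> a + Suc j - 2" using 3 by linarith
      then have "G \<inter> S \<subseteq> h ` {..<a + Suc j - 2}" unfolding h(2)[symmetric] by auto
      then have "G \<subset> h ` {..<a + Suc j - 2} \<union> B" using split(1) G(1) univ by blast
      then show ?thesis using 3 by (simp add: c_def)
    next
      case 4
      have sub: "{..<a + Suc j - 2} \<subseteq> {..<s}" using that s by auto
      have "h ` {..<a + j - 2} \<subset> h ` {..<a + Suc j - 2}"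
        by (rule h_less) (use that s 4 a in auto)
      moreover have "h ` {..<a + Suc j - 2} \<inter> B = {}" using hX(1)[OF sub] disj by blast
      ultimately have "h ` {..<a + j - 2} \<union> B \<subset> h ` {..<a + Suc j - 2} \<union> B" by blast
      then show ?thesis using 4 by (simp add: c_def)
    qed
  qed

  text \<open>
    The copy of \<open>P\<close> uses elements of \<open>S\<close> outside the chain, plus one more atom: \<open>B\<close> if \<open>G\<close> is the
    top of the chain (so that nothing is contained in \<open>G\<close>), and a spare element of \<open>S\<close> otherwise
    (so that the copy is disjoint from the chain).
  \<close>
  define W where "W = (if g = m then B else {h (a + m)})"
  \<comment> \<open>The shift puts the copy on indices from \<open>a + m + 1\<close> to
    \<open>a + m + l = s - 1\<close>, past the chain and past the spare index
    \<open>a + m\<close>.\<close>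
  define \<phi> where "\<phi> x = h (a + m + x)" for x
  define i where "i p = \<phi> ` f p \<union> W" for p
  have \<phi>_eq: "\<phi> ` X = h ` ((+) (a + m) ` X)" for X
    by (auto simp: \<phi>_def image_image)
  have shift: "(+) (a + m) ` f p \<subseteq> {a + m<..<s}" if "p \<in> Field P" for p
    using f(1)[OF that] s by auto
  have \<phi>_sub: "\<phi> ` f p \<subseteq> S" and \<phi>_card: "card (\<phi> ` f p) = card (f p)" if "p \<in> Field P" for p
  proof -
    have sub: "(+) (a + m) ` f p \<subseteq> {..<s}" using shift[OF that] by auto
    show "\<phi> ` f p \<subseteq> S" using hX(1)[OF sub] by (simp add: \<phi>_eq)
    show "card (\<phi> ` f p) = card (f p)" using hX(2)[OF sub] by (simp add: \<phi>_eq card_image)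
  qed
  have h_disj: "h ` X \<inter> h ` Y = {}" if "X \<inter> Y = {}" "X \<subseteq> {..<s}" "Y \<subseteq> {..<s}" for X Y
    using inj_on_image_Int[OF inj that(2,3)] that(1) by simp
  have am: "a + m < s" using s by simp
  have z: "h (a + m) \<in> S" using hS am by auto
  have new: "h x \<notin> \<phi> ` f p" if p: "p \<in> Field P" and "x \<le> a + m" for p x
  proof -
    have "{x} \<inter> (+) (a + m) ` f p = {}" "(+) (a + m) ` f p \<subseteq> {..<s}" "{x} \<subseteq> {..<s}"
      using shift[OF p] that(2) am by fastforce+
    from h_disj[OF this(1,3,2)] show ?thesis by (simp add: \<phi>_eq)
  qed
  note z_new = new[OF _ order_refl]
  have W_disj: "\<phi> ` f p \<inter> W = {}" if "p \<in> Field P" for p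
    using z_new[OF that] \<phi>_sub[OF that] disj unfolding W_def by (cases "g = m"; simp; blast)
  have i_mem: "i p \<in> blowup_levels s n a m" if p: "p \<in> Field P" for p
  proof (cases "g = m")
    case True
    then show ?thesis
      unfolding i_def W_def
      by (intro lev[where r = "Suc (card (f p))"]) (use f(1)[OF p] \<phi>_sub[OF p] \<phi>_card[OF p] in auto)
  next
    case False
    have "finite (f p)" using f(1)[OF p] finite_subset by blast
    then have "card (insert (h (a + m)) (\<phi> ` f p)) = Suc (card (f p))"
      using z_new[OF p] \<phi>_card[OF p] by simp
    then have "insert (h (a + m)) (\<phi> ` f p) \<union> {} \<in> blowup_levels s n a m"
      by (intro lev[where r = "Suc (card (f p))"]) (use f(1)[OF p] \<phi>_sub[OF p] z in auto)
    then show ?thesis using False by (simp add: i_def W_def)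
  qed
  have inj_\<phi>: "inj_on \<phi> {1..l}"
    by (rule inj_onI) (use inj_onD[OF inj] s in \<open>force simp: \<phi>_def\<close>)
  have i_ord: "(p, q) \<in> P \<longleftrightarrow> i p \<subseteq> i q" if "p \<in> Field P" "q \<in> Field P" for p q
  proof -
    have "i p \<subseteq> i q \<longleftrightarrow> \<phi> ` f p \<subseteq> \<phi> ` f q"
      using W_disj[OF that(1)] unfolding i_def by blast
    also have "\<dots> \<longleftrightarrow> f p \<subseteq> f q"
    proof
      assume sub: "\<phi> ` f p \<subseteq> \<phi> ` f q"
      show "f p \<subseteq> f q"
      proof
        fix x assume x: "x \<in> f p"
        then have "\<phi> x \<in> \<phi> ` f q" using sub by blast
        moreover have "x \<in> {1..l}" "f q \<subseteq> {1..l}"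
          using x f(1)[OF that(1)] f(1)[OF that(2)] by blast+
        ultimately show "x \<in> f q" using inj_on_image_mem_iff[OF inj_\<phi>] by metis
      qed
    qed (rule image_mono)
    finally show ?thesis using f(2)[OF that] by simp
  qed
  have not_below: "\<not> i p \<subseteq> c m" if p: "p \<in> Field P" for p
  proof (cases "g = m")
    case True
    then have "c m = G" "B \<subseteq> i p" by (simp_all add: c_def i_def W_def)
    then show ?thesis using split(1) by blast
  next
    case False
    then have "g < m" by (simp add: g_def)
    then have "c m = h ` {..<a + m - 2} \<union> B" by (simp add: c_def)
    moreover have "h (a + m) \<notin> h ` {..<a + m - 2}"
      using h_disj[of "{a + m}" "{..<a + m - 2}"] am by simp
    moreover have "h (a + m) \<in> i p" using False by (simp add: i_def W_def)
    ultimately show ?thesis using z disj by blast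
  qed
  have not_above: "\<not> c 0 \<subseteq> i p" if p: "p \<in> Field P" for p
  \<comment> \<open>If \<open>c 0\<close> is an initial segment, it contains \<open>h 0\<close>
    because \<open>a\<close> is positive, and the copy avoids \<open>h 0\<close>. Otherwise
    \<open>c 0\<close> is \<open>G\<close>, which meets the block, while \<open>W\<close> is the
    spare element as \<open>g = 0 < m\<close>.\<close>
  proof (cases "0 < g")
    case True
    have "h 0 \<notin> \<phi> ` f p" using new[OF p] by simp
    moreover have "h 0 \<in> S" using hS am by auto
    moreover have "h 0 \<noteq> h (a + m)"
      using h_disj[of "{0}" "{a + m}"] am a by simp
    ultimately have "h 0 \<notin> i p"
      using disj unfolding i_def W_def by (cases "g = m"; simp; blast)
    moreover have "h 0 \<in> c 0" using True a by (simp add: c_def)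
    ultimately show ?thesis by blast
  next
    case False
    then have "i p \<inter> B = {}"
      using m \<phi>_sub[OF p] z disj unfolding i_def W_def by (cases "g = m"; simp; blast)
    moreover have "c 0 = G" using False by (simp add: c_def)
    ultimately show ?thesis using split(2) by blast
  qed
  show ?thesis
    by (rule contains_chain_plusI[OF P, where c = c and i = i])
      (use c_mem c_less i_mem i_ord not_below not_above in auto)
qed

section \<open>The bound independent of \<open>n\<close>\<close>

lemma sat_star_chain_plus_le:
  fixes f :: "'a \<Rightarrow> nat set"
  assumes P: "antisym P" and a: "0 < a" and m: "0 < m" and s: "s = a + m + l + 1"
    and f: "\<And>p. p \<in> Field P \<Longrightarrow> f p \<subseteq> {1..l} \<and> a \<le> Suc (card (f p)) \<and> card (f p) + 1 < a + m"
      "\<And>p q. p \<in> Field P \<Longrightarrow> q \<in> Field P \<Longrightarrow> (p, q) \<in> P \<longleftrightarrow> f p \<subseteq> f q"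
  shows "sat_star n (disjoint_union (chain_poset (Suc m)) P) \<le> 2 ^ Suc s"
proof -
  let ?Q = "disjoint_union (chain_poset (Suc m)) P"
  have ne: "Field ?Q \<noteq> {}"
    by (auto simp: Field_disjoint_union Field_chain_poset)
  have "\<exists>\<F>. induced_saturating n ?Q \<F> \<and> card \<F> \<le> 2 ^ Suc s"
  proof (cases "s < n")
    case True
    have free: "\<not> contains_induced (blowup_levels s n a m) ?Q"
      by (rule not_contains_chain_plus[where r = "blowup_rank s n" and a = a])
        (use blowup_rank_less[OF True] in \<open>auto simp: blowup_levels_def\<close>)
    obtain \<F> where "\<F> \<subseteq> blowup s n" "induced_saturating n ?Q \<F>"
    proof (rule saturating_extension[OF _ _ free])
      show "blowup_levels s n a m \<subseteq> blowup s n" by (auto simp: blowup_levels_def)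
      show "blowup s n \<subseteq> Pow {1..n}" by (auto simp: blowup_def)
    qed (use splitting_set_creates_copy[OF assms] in auto)
    moreover have "finite (blowup s n)"
      by (rule finite_subset[of _ "Pow {1..n}"]) (auto simp: blowup_def)
    ultimately show ?thesis
      using card_mono card_blowup order_trans by metis
  next
    case False
    \<comment> \<open>For \<open>n \<le> s\<close> the whole power set is small enough, so any
      saturating family serves.\<close>
    obtain \<F> where \<F>: "induced_saturating n ?Q \<F>"
      using sat_star_attained(1)[OF ne] by blast
    then have "card \<F> \<le> card (Pow {1..n})"
      by (intro card_mono) (auto simp: induced_saturating_def)
    also have "\<dots> \<le> 2 ^ Suc s"
      using False by (simp only: card_Pow finite_atLeastAtMost card_atLeastAtMost) (intro power_increasing, auto)
    finally show ?thesis using \<F> by blast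
  qed
  then show ?thesis using sat_star_attained(2)[OF ne] order_trans by blast
qed

theorem theorem18:
  fixes k :: nat and P :: "'a rel"
  assumes "0 < k"
    and "Partial_order P" and "finite (Field P)"
    and "int (e_star P) \<le> int k - 2"
  shows "\<exists>K::nat. \<forall>n::nat. sat_star n (disjoint_union (chain_poset k) P) \<le> K"
proof -
  \<comment> \<open>The integer inequality forces \<open>k \<ge> 2\<close>, so
    \<open>m = k - 1\<close> is positive and exceeds \<open>e_star P\<close>.\<close>
  obtain m where m: "k = Suc m" "0 < m" "e_star P < m"
    using assms(4) by (cases k) auto
  \<comment> \<open>For empty \<open>P\<close> the value of \<open>e_star P\<close> is junk, but then no \<open>m\<close> avoids \<open>P\<close>.\<close>
  have "\<not> avoids_levels m P"
  proof (cases "Field P = {}")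
    case True
    then have "contains_induced \<F> P" for \<F>
      by (auto simp: contains_induced_def induced_copy_def bij_betw_def)
    then show ?thesis unfolding avoids_levels_def by (metis add.commute le_add1)
  next
    case False
    then show ?thesis using avoids_levels_e_star(2)[OF assms(2,3)] m(3) by fastforce
  qed
  then obtain l a where "contains_induced (\<Union>j\<in>{a..<a + m}. level l j) P"
    unfolding avoids_levels_def by blast
  then obtain f where f: "f ` Field P \<subseteq> (\<Union>j\<in>{a..<a + m}. level l j)"
    and ord: "\<forall>p\<in>Field P. \<forall>q\<in>Field P. (p, q) \<in> P \<longleftrightarrow> f p \<subseteq> f q"
    by (rule contains_inducedD)
  \<comment> \<open>The window starts at \<open>Suc a\<close> instead of \<open>a\<close>: the extra
    atom raises every set of the copy by one rank, and the bottom of the chain must be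
    nonempty.\<close>
  have "f p \<subseteq> {1..l} \<and> Suc a \<le> Suc (card (f p)) \<and> card (f p) + 1 < Suc a + m"
    if "p \<in> Field P" for p
    using f that by (auto simp: level_def)
  moreover have "antisym P" using assms(2) by (simp add: partial_order_on_def)
  ultimately have "sat_star n (disjoint_union (chain_poset k) P) \<le> 2 ^ Suc (Suc a + m + l + 1)" for n
    unfolding m(1) using m(2) ord by (intro sat_star_chain_plus_le[where f = f and a = "Suc a" and l = l]) simp_all
  then show ?thesis by blast
qed

end
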